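(* For all integers $1\le k\le n$, $D_{k,n}(p,1,1)=B_{n,k}(p)$ as polynomials in $p$.
   Context: **Permutation tableaux.** A permutation tableau contained in a $k\times(n-k)$ rectangle is a partition $\lambda=(\lambda_1\ge\dots\ge\lambda_k\ge 0)$ with $\lambda_1\le n-k$, whose Young diagram $Y_\lambda$ (left-justified, $\lambda_i$ boxes in the $i$-th row from the top) is placed in the top left corner of the rectangle, together with a filling of the boxes of $Y_\lambda$ by $0$'s and $1$'s such that: (1) each of the $n-k$ columns of the rectangle contains at least one $1$; (2) there is no $0$ which has a $1$ above it in the same column and a $1$ to its left in the same row. Rows of length $0$ are allowed. Every box of the rectangle outside $Y_\lambda$ is filled with a $2$. $D_{k,n}(p,q,r)=\sum_{\mathcal{T}}p^{z(\mathcal{T})}q^{u(\mathcal{T})}r^{w(\mathcal{T})}$, the sum over all permutation tableaux $\mathcal{T}$ contained in a $k\times(n-k)$ rectangle, where $z,u,w$ are the numbers of $0$'s, $1$'s and $2$'s of $\mathcal{T}$, respectively. Carlitz' $q$-Eulerian polynomials are $B_{n,k}(q)=\sum_{\pi}q^{\mathrm{maj}(\pi)-\binom{k}{2}}$, where the sum is over permutations $\pi\in\mathcal{S}_n$ with exactly $k-1$ descents; a descent of $\pi=a_1\cdots a_n$ is an $i$ with $a_i>a_{i+1}$, and $\mathrm{maj}(\pi)$ is the sum of all such indices $i$. *)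

theory Defs
  imports
    "HOL-Combinatorics.Permutations"
    "HOL-Library.FuncSet"
    "HOL-Computational_Algebra.Polynomial"
begin

(* A partition contained in a k x m rectangle: exactly k weakly decreasing parts, zero parts
   allowed, each at most m. *)
definition partition_in_rect :: "nat \<Rightarrow> nat \<Rightarrow> nat list \<Rightarrow> bool" where
  "partition_in_rect k m lam \<longleftrightarrow>
     length lam = k \<and> sorted_wrt (\<ge>) lam \<and> (\<forall>x \<in> set lam. x \<le> m)"

(* Rows are indexed from the top and columns from the left, both starting at 0, so that box
   (i, j) of the rectangle lies in the Young diagram iff j < lam ! i. *)
definition rect :: "nat \<Rightarrow> nat \<Rightarrow> (nat \<times> nat) set" where
  "rect k m = {..<k} \<times> {..<m}"

definition young_diagram :: "nat list \<Rightarrow> (nat \<times> nat) set" where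
  "young_diagram lam = {(i, j). i < length lam \<and> j < lam ! i}"

(* The filling is extensional on the rectangle (undefined outside it), so that every tableau
   is represented by exactly one pair (lam, f). *)
definition permutation_tableaux ::
    "nat \<Rightarrow> nat \<Rightarrow> (nat list \<times> (nat \<times> nat \<Rightarrow> nat)) set" where
  "permutation_tableaux k m = {(lam, f).
     partition_in_rect k m lam \<and>
     f \<in> extensional (rect k m) \<and>
     (\<forall>b \<in> young_diagram lam. f b \<in> {0, 1}) \<and>
     (\<forall>b \<in> rect k m - young_diagram lam. f b = 2) \<and>
     (\<forall>j < m. \<exists>i < k. f (i, j) = 1) \<and>
     \<not> (\<exists>i j i' j'. (i, j) \<in> young_diagram lam \<and> f (i, j) = 0 \<and>
            i' < i \<and> f (i', j) = 1 \<and> j' < j \<and> f (i, j') = 1)}"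

definition num_entries :: "nat \<Rightarrow> nat \<Rightarrow> nat \<Rightarrow> (nat \<times> nat \<Rightarrow> nat) \<Rightarrow> nat" where
  "num_entries k m c f = card {b \<in> rect k m. f b = c}"

(* The polynomial D_{k,n} as a generic expression in elements p, q, r of any commutative
   semiring; taking these to be indeterminates of a polynomial ring gives the polynomial. *)
definition D_tab :: "nat \<Rightarrow> nat \<Rightarrow> 'a::comm_semiring_1 \<Rightarrow> 'a \<Rightarrow> 'a \<Rightarrow> 'a" where
  "D_tab k n p q r =
     (\<Sum>(lam, f) \<in> permutation_tableaux k (n - k).
        p ^ num_entries k (n - k) 0 f * q ^ num_entries k (n - k) 1 f *
        r ^ num_entries k (n - k) 2 f)"

definition descents :: "nat \<Rightarrow> (nat \<Rightarrow> nat) \<Rightarrow> nat set" where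
  "descents n w = {i \<in> {1..<n}. w i > w (i + 1)}"

definition maj :: "nat \<Rightarrow> (nat \<Rightarrow> nat) \<Rightarrow> nat" where
  "maj n w = \<Sum> (descents n w)"

(* The natural-number subtraction in the exponent does not truncate, see
   choose_two_le_maj below. *)
definition carlitz_B :: "nat \<Rightarrow> nat \<Rightarrow> 'a::comm_semiring_1 \<Rightarrow> 'a" where
  "carlitz_B n k q =
     (\<Sum>w \<in> {w. w permutes {1..n} \<and> card (descents n w) + 1 = k}.
        q ^ (maj n w - (k choose 2)))"

lemma choose_two_le_sum:
  fixes A :: "nat set"
  assumes "finite A" "0 \<notin> A"
  shows "(card A + 1) choose 2 \<le> \<Sum> A"
  using assms
proof (induction "card A" arbitrary: A)
  case 0
  then show ?case by simp
next
  case (Suc c)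
  define M where "M = Max A"
  have ne: "A \<noteq> {}" using Suc.hyps(2) by auto
  have M: "M \<in> A" using ne Suc.prems unfolding M_def by simp
  have c: "c = card (A - {M})" using Suc.hyps(2) Suc.prems M by simp
  have "A \<subseteq> {1..M}"
    using Suc.prems unfolding M_def by (auto simp: Suc_le_eq intro: gr0I)
  then have "Suc c \<le> M"
    using card_mono[of "{1..M}" A] Suc.hyps(2) by simp
  moreover have "(c + 1) choose 2 \<le> \<Sum> (A - {M})"
    using Suc.hyps(1)[OF c] Suc.prems c by simp
  moreover have "\<Sum> A = M + \<Sum> (A - {M})"
    using Suc.prems M by (simp add: sum.remove)
  moreover have "(Suc c + 1) choose 2 = Suc c + ((c + 1) choose 2)"
    by (simp add: numeral_2_eq_2)
  ultimately show ?case using Suc.hyps(2) by simp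
qed

lemma choose_two_le_maj:
  assumes "card (descents n w) + 1 = k"
  shows "k choose 2 \<le> maj n w"
  using choose_two_le_sum[of "descents n w"] assms
  by (simp add: maj_def descents_def)

lemma finite_permutation_tableaux: "finite (permutation_tableaux k m)"
proof (rule finite_subset)
  show "permutation_tableaux k m \<subseteq>
      {lam. set lam \<subseteq> {..m} \<and> length lam = k} \<times> (rect k m \<rightarrow>\<^sub>E {0, 1, 2})"
    unfolding permutation_tableaux_def partition_in_rect_def PiE_def by fastforce
  show "finite ({lam. set lam \<subseteq> {..m} \<and> length lam = k} \<times> (rect k m \<rightarrow>\<^sub>E {0, 1, 2::nat}))"
    by (intro finite_cartesian_product finite_lists_length_eq finite_PiE)
       (auto simp: rect_def)
qed

end

theory Submission
  imports Defs
begin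

text \<open>
  Inserting \<open>n + 1\<close> at the \<open>n + 1\<close> places of a permutation of \<open>{1..n}\<close> raises \<open>maj\<close> by each of
  \<open>0, \<dots>, n\<close> exactly once, the smallest increments being those that preserve the number of descents. This is
  Carlitz' recurrence \<open>B(n + 1, k + 1) = [k + 1] B(n, k + 1) + [n + 1 - k] B(n, k)\<close>.

  Call a row of a tableau free if none of its zeros has a 1 above it. If the last row is empty, delete
  it; otherwise the first column is full, its ones form a nonempty set of rows that are free in the
  rest of the tableau, and any such set occurs. Hence the generating function
  \<open>H\<^sub>t(k, m)\<close> in which a tableau with \<open>u\<close> free rows and \<open>z\<close> zeros has weight
  \<open>p\<^sup>z p\<^bsup>t (k - u)\<^esup> [t + 1]\<^sup>u\<close> satisfies
  \<open>H\<^sub>t(k, m) = [t + 1] (H\<^sub>t(k - 1, m) + H\<^bsub>t + 1\<^esub>(k, m - 1) - p\<^sup>k H\<^sub>t(k, m - 1))\<close>. By induction this implies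
  \<open>H\<^sub>t(k, m) = [k] H\<^sub>t(k, m - 1) + [m + t + 1] H\<^sub>t(k - 1, m)\<close>, which at \<open>t = 0\<close> is Carlitz' recurrence.
\<close>

definition q_nat :: "'a::comm_semiring_1 \<Rightarrow> nat \<Rightarrow> 'a" where
  "q_nat q n = (\<Sum>i<n. q ^ i)"

lemma q_nat_0 [simp]: "q_nat q 0 = 0"
  and q_nat_1 [simp]: "q_nat q (Suc 0) = 1"
  and q_nat_Suc: "q_nat q (Suc n) = q_nat q n + q ^ n"
  by (simp_all add: q_nat_def)

lemma q_nat_Suc_shift: "q_nat q (Suc n) = 1 + q * q_nat q n"
  by (simp add: q_nat_def sum.lessThan_Suc_shift sum_distrib_left del: sum.lessThan_Suc)

subsection \<open>Inserting a largest letter into a permutation\<close>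

text \<open>A cycle acting on positions. If \<open>w\<close> permutes \<open>{1..n}\<close>, it
  fixes \<open>n + 1\<close>, so in \<open>w \<circ> insert_cycle n i\<close> the letter
  \<open>n + 1\<close> stands after the first \<open>i\<close> letters of \<open>w\<close> and the
  remaining letters move one place to the right.\<close>

definition insert_cycle :: "nat \<Rightarrow> nat \<Rightarrow> nat \<Rightarrow> nat" where
  "insert_cycle n i x =
     (if x = Suc i then Suc n else if Suc i < x \<and> x \<le> Suc n then x - 1 else x)"

lemma insert_cycle_permutes:
  assumes "i \<le> n"
  shows "insert_cycle n i permutes {1..Suc n}"
proof (rule bij_imp_permutes)
  have "inj_on (insert_cycle n i) {1..Suc n}"
    by (auto simp: inj_on_def insert_cycle_def split: if_splits)
  moreover have "insert_cycle n i ` {1..Suc n} \<subseteq> {1..Suc n}"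
    using assms by (auto simp: insert_cycle_def)
  ultimately show "bij_betw (insert_cycle n i) {1..Suc n} {1..Suc n}"
    by (simp add: bij_betw_def endo_inj_surj)
qed (use assms in \<open>auto simp: insert_cycle_def\<close>)

text \<open>The letter \<open>n + 1\<close> stands at position \<open>i + 1\<close>, so the result
  determines \<open>i\<close>; composing with the inverse cycle then recovers
  \<open>w\<close>.\<close>

lemma bij_betw_insert_max:
  "bij_betw (\<lambda>(w, i). w \<circ> insert_cycle n i)
     ({w. w permutes {1..n}} \<times> {..n}) {w. w permutes {1..Suc n}}"
proof (rule bij_betw_imageI)
  have max: "(w \<circ> insert_cycle n i) x = Suc n \<longleftrightarrow> x = Suc i"
    if "w permutes {1..n}" "i \<le> n" for w i x
  proof -
    have "w (Suc n) = Suc n"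
      using that by (intro permutes_not_in) auto
    moreover have "insert_cycle n i x = Suc n \<longleftrightarrow> x = Suc i"
      using that(2) by (auto simp: insert_cycle_def)
    ultimately show ?thesis
      using permutes_inj[OF that(1)] by (metis comp_apply injD)
  qed
  show "inj_on (\<lambda>(w, i). w \<circ> insert_cycle n i) ({w. w permutes {1..n}} \<times> {..n})"
  proof (clarsimp simp: inj_on_def)
    fix w v i j
    assume *: "w permutes {Suc 0..n}" "i \<le> n" "v permutes {Suc 0..n}" "j \<le> n"
      "w \<circ> insert_cycle n i = v \<circ> insert_cycle n j"
    have "i = j"
      using max[of w i "Suc i"] max[of v j "Suc i"] * by simp
    with * have "w = v"
      by (metis insert_cycle_permutes comp_assoc comp_id permutes_inv_o(1))
    with \<open>i = j\<close> show "w = v \<and> i = j" by simp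
  qed
  show "(\<lambda>(w, i). w \<circ> insert_cycle n i) ` ({w. w permutes {1..n}} \<times> {..n}) =
      {w. w permutes {1..Suc n}}" (is "?L = ?R")
  proof
    show "?L \<subseteq> ?R"
    proof
      fix v assume "v \<in> ?L"
      then obtain w i where v: "v = w \<circ> insert_cycle n i"
        and w: "w permutes {1..n}" and i: "i \<le> n" by auto
      have "w permutes {1..Suc n}" by (rule permutes_subset[OF w]) auto
      then show "v \<in> ?R"
        unfolding v mem_Collect_eq by (intro permutes_compose insert_cycle_permutes i)
    qed
    show "?R \<subseteq> ?L"
    proof
      fix w assume "w \<in> ?R"
      then have w: "w permutes {1..Suc n}" by simp
      have "Suc n \<in> w ` {1..Suc n}"
        using permutes_image[OF w] by simp
      then obtain x where x: "x \<in> {1..Suc n}" "w x = Suc n" by auto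
      define i where "i = x - 1"
      have i: "i \<le> n" "w (Suc i) = Suc n" using x by (auto simp: i_def)
      have c: "insert_cycle n i permutes {1..Suc n}"
        by (rule insert_cycle_permutes[OF i(1)])
      define v where "v = w \<circ> inv (insert_cycle n i)"
      have "insert_cycle n i (Suc i) = Suc n" by (simp add: insert_cycle_def)
      then have "v (Suc n) = Suc n"
        using i(2) permutes_inverses(2)[OF c, of "Suc i"] by (simp add: v_def)
      moreover have "v permutes {1..Suc n}"
        unfolding v_def by (intro permutes_compose permutes_inv c w)
      ultimately have "v permutes {1..n}"
        by (elim permutes_superset) (auto simp: le_Suc_eq)
      moreover have "w = v \<circ> insert_cycle n i"
        by (simp add: v_def comp_assoc permutes_inv_o(2)[OF c])
      ultimately show "w \<in> ?L" using i(1) by auto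
    qed
  qed
qed

text \<open>The new letter exceeds all others: it makes an ascent with its left neighbour, which
  destroys a descent at \<open>i\<close>, and a descent with its right neighbour if there is one.
  Descents further left stay and those further right move by one.\<close>

lemma descents_insert_max:
  assumes w: "w permutes {1..n}" and i: "i \<le> n"
  shows "descents (Suc n) (w \<circ> insert_cycle n i) =
    {x \<in> descents n w. x < i} \<union> (if i < n then {Suc i} else {}) \<union>
    Suc ` {x \<in> descents n w. i < x}" (is "_ = ?R")
proof (rule set_eqI)
  fix x
  have le: "w y \<le> n" if "1 \<le> y" "y \<le> n" for y
    using permutes_in_image[OF w, of y] that by simp
  have S: "w (Suc n) = Suc n"
    using w by (intro permutes_not_in) auto
  show "x \<in> descents (Suc n) (w \<circ> insert_cycle n i) \<longleftrightarrow> x \<in> ?R"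
  proof (cases "1 \<le> x \<and> x \<le> n")
    case False
    then show ?thesis using i by (auto simp: descents_def)
  next
    case True
    consider "x < i" | "x = i" | "x = Suc i" | "Suc i < x" by linarith
    then show ?thesis
    proof cases
      case 1
      then show ?thesis using True i by (auto simp: descents_def insert_cycle_def)
    next
      case 2
      then show ?thesis using True i le[of x] S
        by (auto simp: descents_def insert_cycle_def)
    next
      case 3
      then have "w x < w (Suc n)" using True le[of x] S by simp
      then show ?thesis using 3 True i by (auto simp: descents_def insert_cycle_def)
    next
      case 4
      then obtain y where y: "x = Suc y" by (cases x) auto
      then show ?thesis using True i 4
        by (auto simp: descents_def insert_cycle_def image_iff)
    qed
  qed
qed

section \<open>The effect of an insertion on the number of descents and on maj\<close>

definition descents_from :: "nat \<Rightarrow> (nat \<Rightarrow> nat) \<Rightarrow> nat \<Rightarrow> nat" where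
  "descents_from n w i = card {x \<in> descents n w. i \<le> x}"

lemma finite_descents [simp]: "finite (descents n w)"
  by (simp add: descents_def)

lemma descents_bounds: "x \<in> descents n w \<Longrightarrow> 1 \<le> x \<and> x < n"
  by (simp add: descents_def)

text \<open>Each descent after \<open>i\<close> moves by one place. A descent at \<open>i\<close> is
  replaced by one at \<open>i + 1\<close>, which also adds 1 to \<open>maj\<close>, and
  \<open>descents_from\<close> counts it too. If \<open>i\<close> is neither a descent nor the end,
  the descent at \<open>i + 1\<close> is an additional one.\<close>

lemma insert_max_stats:
  assumes w: "w permutes {1..n}" and i: "i \<le> n"
  shows "card (descents (Suc n) (w \<circ> insert_cycle n i)) =
      card (descents n w) + (if i \<in> descents n w \<union> {n} then 0 else 1)"
    and "maj (Suc n) (w \<circ> insert_cycle n i) =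
      maj n w + descents_from n w i + (if i \<in> descents n w \<union> {n} then 0 else Suc i)"
proof -
  define D where "D = descents n w"
  define L where "L = {x \<in> D. x < i}"
  define R where "R = {x \<in> D. i < x}"
  define M where "M = (if i < n then {Suc i} else {})"
  have D_in: "D = insert i (L \<union> R)" if "i \<in> D"
    using that by (auto simp: L_def R_def)
  have D_out: "D = L \<union> R" if "i \<notin> D"
    using that by (auto simp: L_def R_def intro: linorder_neqE_nat)
  have fin: "finite L" "finite R" "finite M" by (auto simp: L_def R_def D_def M_def)
  have disj: "L \<inter> R = {}" "i \<notin> L" "i \<notin> R" by (auto simp: L_def R_def)
  have new: "descents (Suc n) (w \<circ> insert_cycle n i) = L \<union> M \<union> Suc ` R"
    using descents_insert_max[OF assms] by (simp add: L_def R_def M_def D_def)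
  have newdisj: "(L \<union> M) \<inter> Suc ` R = {}" "L \<inter> M = {}"
    by (auto simp: L_def R_def M_def)
  have D_n: "i \<in> D \<Longrightarrow> i < n" using descents_bounds D_def by blast
  have "card (L \<union> M \<union> Suc ` R) = card L + card M + card R"
    using fin newdisj by (simp add: card_Un_disjoint card_image)
  moreover have "card D = card L + card R + (if i \<in> D then 1 else 0)"
    using arg_cong[OF D_in, of card] arg_cong[OF D_out, of card] fin disj
    by (cases "i \<in> D") (simp_all add: card_Un_disjoint)
  ultimately show "card (descents (Suc n) (w \<circ> insert_cycle n i)) =
      card (descents n w) + (if i \<in> descents n w \<union> {n} then 0 else 1)"
    unfolding new D_def[symmetric] using D_n i by (auto simp: M_def)
  have "\<Sum> (L \<union> M \<union> Suc ` R) = \<Sum> L + \<Sum> M + sum Suc R"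
    using fin newdisj by (simp add: sum.union_disjoint sum.reindex)
  moreover have "sum Suc R = \<Sum> R + card R"
    using sum_Suc[of "\<lambda>x. x" R] by simp
  moreover have "\<Sum> D = \<Sum> L + \<Sum> R + (if i \<in> D then i else 0)"
    using arg_cong[OF D_in, of \<Sum>] arg_cong[OF D_out, of \<Sum>] fin disj
    by (cases "i \<in> D") (simp_all add: sum.union_disjoint)
  moreover have "descents_from n w i = card R + (if i \<in> D then 1 else 0)"
  proof -
    have "{x \<in> D. i \<le> x} = R \<union> (if i \<in> D then {i} else {})"
      by (auto simp: R_def order.strict_iff_order)
    then show ?thesis using fin disj
      by (cases "i \<in> D") (simp_all add: descents_from_def D_def)
  qed
  ultimately show "maj (Suc n) (w \<circ> insert_cycle n i) =
      maj n w + descents_from n w i + (if i \<in> descents n w \<union> {n} then 0 else Suc i)"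
    unfolding maj_def new D_def[symmetric] using D_n i by (auto simp: M_def)
qed

lemma descents_from_split:
  assumes "i \<le> j"
  shows "descents_from n w i = card {x \<in> descents n w. i \<le> x \<and> x < j} + descents_from n w j"
proof -
  have "{x \<in> descents n w. i \<le> x} =
      {x \<in> descents n w. i \<le> x \<and> x < j} \<union> {x \<in> descents n w. j \<le> x}"
    using assms by auto
  then show ?thesis
    unfolding descents_from_def by (simp add: card_Un_disjoint disjoint_iff)
qed

lemma descents_from_0: "descents_from n w 0 = card (descents n w)"
  by (simp add: descents_from_def)

lemma descents_from_n: "descents_from n w n = 0"
  using descents_bounds[of _ n w] by (force simp: descents_from_def)

text \<open>These places preserve the number \<open>d\<close> of descents. The increment of
  \<open>maj\<close> drops strictly from each of them to the next, and \<open>d + 1\<close> distinct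
  values in \<open>{..d}\<close> exhaust it.\<close>

lemma bij_betw_descents_from:
  "bij_betw (descents_from n w) (descents n w \<union> {n}) {..card (descents n w)}"
proof -
  have less: "descents_from n w j < descents_from n w i"
    if "i \<in> descents n w" "i < j" for i j
    using descents_from_split[of i j n w] that by (auto simp: card_gt_0_iff)
  have inj: "inj_on (descents_from n w) (descents n w \<union> {n})"
  proof (rule linorder_inj_onI')
    fix i j assume "i \<in> descents n w \<union> {n}" "j \<in> descents n w \<union> {n}" "i < j"
    then show "descents_from n w i \<noteq> descents_from n w j"
      using less[of i j] descents_bounds[of j n w] by auto
  qed
  moreover have "descents_from n w ` (descents n w \<union> {n}) \<subseteq> {..card (descents n w)}"
    by (auto simp: descents_from_def intro!: card_mono)
  moreover have "card (descents n w \<union> {n}) = card {..card (descents n w)}"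
    using descents_bounds[of n n w] by (subst card_Un_disjoint) auto
  ultimately show ?thesis
    unfolding bij_betw_def by (intro conjI card_subset_eq) (simp_all only: card_image finite_atMost)
qed

text \<open>These places create a descent. From \<open>i\<close> to a later \<open>j\<close> the
  increment gains \<open>j - i\<close> and loses the descents in between, which are fewer than
  \<open>j - i\<close> because \<open>i\<close> is not one of them. So it grows strictly, and the
  \<open>n - d\<close> values fill the interval.\<close>

lemma bij_betw_non_descents:
  "bij_betw (\<lambda>i. Suc i + descents_from n w i) ({..<n} - descents n w)
     {Suc (card (descents n w))..n}"
proof -
  let ?e = "\<lambda>i. Suc i + descents_from n w i" and ?N = "{..<n} - descents n w"
  have few: "card {x \<in> descents n w. i \<le> x \<and> x < j} < j - i"
    if "i \<notin> descents n w" "i < j" for i j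
  proof -
    have "{x \<in> descents n w. i \<le> x \<and> x < j} \<subseteq> {Suc i..<j}"
      using that by (auto simp: Suc_le_eq) (metis le_neq_implies_less)
    then have "card {x \<in> descents n w. i \<le> x \<and> x < j} \<le> card {Suc i..<j}"
      by (intro card_mono) auto
    then show ?thesis using that by simp
  qed
  have less: "?e i < ?e j" if "i \<notin> descents n w" "i < j" for i j
    using few[OF that] descents_from_split[of i j n w] that by simp
  have inj: "inj_on ?e ?N"
    by (rule linorder_inj_onI') (use less in fastforce)
  moreover have "?e ` ?N \<subseteq> {Suc (card (descents n w))..n}"
  proof clarsimp
    fix i assume i: "i < n" "i \<notin> descents n w"
    \<comment> \<open>As 0 is not a descent, \<open>few\<close> applies from 0 and bounds the number
      of descents before \<open>i\<close> by \<open>i\<close>; this gives the lower end of the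
      interval.\<close>
    have "0 \<notin> descents n w" using descents_bounds[of 0 n w] by auto
    then have "card {x \<in> descents n w. 0 \<le> x \<and> x < i} \<le> i"
      using few[of 0 i] by (cases i) auto
    then show "card (descents n w) \<le> i + descents_from n w i \<and>
        Suc (i + descents_from n w i) \<le> n"
      using few[OF i(2,1)] descents_from_split[of i n n w] i
        descents_from_split[of 0 i n w] descents_from_n[of n w] descents_from_0[of n w]
      by auto
  qed
  moreover have "card ?N = card {Suc (card (descents n w))..n}"
    using descents_bounds[of _ n w] by (subst card_Diff_subset) auto
  ultimately show ?thesis
    unfolding bij_betw_def by (intro conjI card_subset_eq) (simp_all only: card_image finite_atLeastAtMost)
qed

text \<open>Permutations with \<open>k\<close> descents arise from those with \<open>k\<close>
  descents, with increments \<open>0, ..., k\<close>, and from those with \<open>k - 1\<close>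
  descents, with increments \<open>k, ..., n\<close>. In the second case the normalisation grows by
  \<open>(k + 1 choose 2) - (k choose 2) = k\<close>, which leaves the exponents
  \<open>0, ..., n - k\<close>.\<close>

lemma carlitz_B_Suc:
  fixes q :: "'a::comm_semiring_1"
  shows "carlitz_B (Suc n) (Suc k) q =
    q_nat q (Suc k) * carlitz_B n (Suc k) q + q_nat q (Suc n - k) * carlitz_B n k q"
proof -
  let ?P = "{w. w permutes {1..n}}"
  let ?d = "\<lambda>w. card (descents n w)"
  let ?g = "\<lambda>w. q ^ (maj (Suc n) w - (Suc k choose 2))"
  have fin: "finite ?P" by (simp add: finite_permutations)
  have C: "Suc k choose 2 = (k choose 2) + k" by (simp add: numeral_2_eq_2)
  have inner: "(\<Sum>i\<le>n. if card (descents (Suc n) (w \<circ> insert_cycle n i)) = k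
          then ?g (w \<circ> insert_cycle n i) else 0) =
      (if ?d w = k then q_nat q (Suc k) * q ^ (maj n w - (Suc k choose 2)) else 0) +
      (if Suc (?d w) = k then q_nat q (Suc n - k) * q ^ (maj n w - (k choose 2)) else 0)"
    (is "?lhs = _") if w: "w permutes {1..n}" for w
  proof -
    let ?A = "descents n w \<union> {n}" and ?N = "{..<n} - descents n w"
    let ?f = "\<lambda>i. if card (descents (Suc n) (w \<circ> insert_cycle n i)) = k
          then ?g (w \<circ> insert_cycle n i) else 0"
    have split: "{..n} = ?A \<union> ?N" "?A \<inter> ?N = {}"
      using descents_bounds[of _ n w] by force+
    have "sum ?f ?A = (if ?d w = k
        then q_nat q (Suc k) * q ^ (maj n w - (Suc k choose 2)) else 0)"
    proof (cases "?d w = k")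
      case True
      \<comment> \<open>This bound makes the subtraction in the exponent exact, so the increment can
        be split off as a factor.\<close>
      have le: "Suc k choose 2 \<le> maj n w"
        by (rule choose_two_le_maj) (simp add: True)
      have "sum ?f ?A = (\<Sum>i\<in>?A. q ^ descents_from n w i * q ^ (maj n w - (Suc k choose 2)))"
      proof (rule sum.cong)
        fix i assume i: "i \<in> ?A"
        then have "i \<le> n" using descents_bounds[of i n w] by auto
        then show "?f i = q ^ descents_from n w i * q ^ (maj n w - (Suc k choose 2))"
          using insert_max_stats[OF w, of i] i True le by (simp add: add.commute flip: power_add)
      qed simp
      also have "\<dots> = (\<Sum>e\<le>k. q ^ e * q ^ (maj n w - (Suc k choose 2)))"
        using sum.reindex_bij_betw[OF bij_betw_descents_from[of n w]] True by auto
      also have "\<dots> = q_nat q (Suc k) * q ^ (maj n w - (Suc k choose 2))"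
        by (simp only: q_nat_def sum_distrib_right lessThan_Suc_atMost)
      finally show ?thesis using True by simp
    next
      case False
      have "?f i = 0" if "i \<in> ?A" for i
        using that insert_max_stats(1)[OF w, of i] descents_bounds[of i n w] False by auto
      then show ?thesis using False by (simp add: sum.neutral)
    qed
    moreover have "sum ?f ?N = (if Suc (?d w) = k
        then q_nat q (Suc n - k) * q ^ (maj n w - (k choose 2)) else 0)"
    proof (cases "Suc (?d w) = k")
      case True
      have le: "k choose 2 \<le> maj n w"
        by (rule choose_two_le_maj) (simp add: True)
      let ?e = "\<lambda>i. Suc i + descents_from n w i"
      have "sum ?f ?N = (\<Sum>i\<in>?N. q ^ (?e i - k) * q ^ (maj n w - (k choose 2)))"
      proof (rule sum.cong)
        fix i assume i: "i \<in> ?N"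
        then have "?e i \<in> {k..n}"
          using bij_betw_imp_surj_on[OF bij_betw_non_descents[of n w]] True by blast
        then show "?f i = q ^ (?e i - k) * q ^ (maj n w - (k choose 2))"
          using insert_max_stats[OF w, of i] i True le
          by (auto simp: C simp flip: power_add intro!: arg_cong[where f = "\<lambda>e. q ^ e"])
      qed simp
      also have "\<dots> = (\<Sum>e\<in>{k..n}. q ^ (e - k) * q ^ (maj n w - (k choose 2)))"
        using sum.reindex_bij_betw[OF bij_betw_non_descents[of n w],
            of "\<lambda>e. q ^ (e - k) * q ^ (maj n w - (k choose 2))"] True by simp
      also have "\<dots> = (\<Sum>e<Suc n - k. q ^ e * q ^ (maj n w - (k choose 2)))"
        by (rule sum.reindex_bij_witness[of _ "\<lambda>e. e + k" "\<lambda>e. e - k"]) auto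
      also have "\<dots> = q_nat q (Suc n - k) * q ^ (maj n w - (k choose 2))"
        by (simp only: q_nat_def sum_distrib_right)
      finally show ?thesis using True by simp
    next
      case False
      have "?f i = 0" if "i \<in> ?N" for i
        using that insert_max_stats(1)[OF w, of i] False by auto
      then show ?thesis using False by (simp add: sum.neutral)
    qed
    moreover have "?lhs = sum ?f ?A + sum ?f ?N"
      unfolding split(1) using split(2) by (intro sum.union_disjoint) auto
    ultimately show ?thesis by simp
  qed
  have "carlitz_B (Suc n) (Suc k) q =
      (\<Sum>w | w permutes {1..Suc n}. if card (descents (Suc n) w) = k then ?g w else 0)"
    unfolding carlitz_B_def by (simp add: sum.If_cases finite_permutations Int_def)
  also have "\<dots> = (\<Sum>(w, i)\<in>?P \<times> {..n}.
      if card (descents (Suc n) (w \<circ> insert_cycle n i)) = k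
      then ?g (w \<circ> insert_cycle n i) else 0)"
    by (subst sum.reindex_bij_betw[OF bij_betw_insert_max, symmetric])
       (rule sum.cong, auto)
  also have "\<dots> = (\<Sum>w\<in>?P.
      (if ?d w = k then q_nat q (Suc k) * q ^ (maj n w - (Suc k choose 2)) else 0) +
      (if Suc (?d w) = k then q_nat q (Suc n - k) * q ^ (maj n w - (k choose 2)) else 0))"
    by (subst sum.cartesian_product[symmetric], rule sum.cong) (use inner in auto)
  also have "\<dots> = q_nat q (Suc k) * carlitz_B n (Suc k) q +
      q_nat q (Suc n - k) * carlitz_B n k q"
  proof -
    have "(\<Sum>w\<in>?P. if Q w then g w else 0) = (\<Sum>w | w permutes {1..n} \<and> Q w. g w)"
      for Q and g :: "(nat \<Rightarrow> nat) \<Rightarrow> 'a"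
      using fin by (simp add: sum.If_cases Int_def)
    then show ?thesis
      by (simp only: carlitz_B_def sum.distrib sum_distrib_left Suc_eq_plus1 add_right_cancel)
  qed
  finally show ?thesis .
qed

section \<open>Boundary values of the q-Eulerian polynomials\<close>

lemma carlitz_B_eq_0:
  assumes "1 \<le> n" "n < k"
  shows "carlitz_B n k q = 0"
proof -
  have "card (descents n w) + 1 \<noteq> k" for w
  proof -
    have "descents n w \<subseteq> {1..<n}" by (auto simp: descents_def)
    then have "card (descents n w) \<le> n - 1"
      using card_mono[of "{1..<n}" "descents n w"] by simp
    \<comment> \<open>For \<open>n = 0\<close> this would fail: the empty permutation has no
      descents and gives \<open>carlitz_B 0 1 q = 1\<close>.\<close>
    then show ?thesis using assms by linarith
  qed
  then show ?thesis by (simp add: carlitz_B_def)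
qed

lemma carlitz_B_0: "carlitz_B n 0 q = 0"
  by (simp add: carlitz_B_def)

lemma carlitz_B_1: "carlitz_B 1 1 q = 1"
proof -
  have "{w. w permutes {1..1::nat} \<and> card (descents 1 w) + 1 = 1} = {id}"
    by (auto simp: descents_def)
  then show ?thesis by (simp add: carlitz_B_def maj_def descents_def)
qed

subsection \<open>Tableaux as fillings of the rectangle\<close>

text \<open>A tableau stored without its partition: the shape is the set of boxes not containing 2.
  That the shape is a Young diagram becomes the condition that the 2's are closed under moving right
  and down.\<close>

definition fillings :: "nat \<Rightarrow> nat \<Rightarrow> (nat \<times> nat \<Rightarrow> nat) set" where
  "fillings k m = {f.
     f \<in> extensional (rect k m) \<and>
     (\<forall>i<k. \<forall>j<m. f (i, j) \<in> {0, 1, 2}) \<and>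
     (\<forall>i'<k. \<forall>j'<m. \<forall>i\<le>i'. \<forall>j\<le>j'. f (i, j) = 2 \<longrightarrow> f (i', j') = 2) \<and>
     (\<forall>j<m. \<exists>i<k. f (i, j) = 1) \<and>
     (\<forall>i<k. \<forall>j<m. f (i, j) = 0 \<longrightarrow> (\<exists>i'<i. f (i', j) = 1) \<longrightarrow> (\<forall>j'<j. f (i, j') \<noteq> 1))}"

lemma fillingsI:
  assumes "f \<in> extensional (rect k m)"
    and "\<And>i j. i < k \<Longrightarrow> j < m \<Longrightarrow> f (i, j) \<in> {0, 1, 2}"
    and "\<And>i j i' j'. i' < k \<Longrightarrow> j' < m \<Longrightarrow> i \<le> i' \<Longrightarrow> j \<le> j' \<Longrightarrow> f (i, j) = 2 \<Longrightarrow> f (i', j') = 2"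
    and "\<And>j. j < m \<Longrightarrow> \<exists>i<k. f (i, j) = 1"
    and "\<And>i j i' j'. i < k \<Longrightarrow> j < m \<Longrightarrow> f (i, j) = 0 \<Longrightarrow> i' < i \<Longrightarrow> f (i', j) = 1 \<Longrightarrow>
      j' < j \<Longrightarrow> f (i, j') \<noteq> 1"
  shows "f \<in> fillings k m"
  unfolding fillings_def mem_Collect_eq
proof (intro conjI allI impI)
  fix i j j' assume "i < k" "j < m" "f (i, j) = 0" "\<exists>i'<i. f (i', j) = 1" "j' < j"
  then show "f (i, j') \<noteq> 1" using assms(5) by blast
next
  fix i' j' i j assume "i' < k" "j' < m" "i \<le> i'" "j \<le> j'" "f (i, j) = 2"
  then show "f (i', j') = 2" by (rule assms(3))
qed (fact assms(1,2,4))+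

lemma fillings_two_mono:
  assumes "f \<in> fillings k m" "i' < k" "j' < m" "i \<le> i'" "j \<le> j'" "f (i, j) = 2"
  shows "f (i', j') = 2"
  using assms unfolding fillings_def by blast

lemma fillings_zero:
  assumes "f \<in> fillings k m" "i < k" "j < m" "f (i, j) = 0" "i' < i" "f (i', j) = 1" "j' < j"
  shows "f (i, j') \<noteq> 1"
  using assms unfolding fillings_def by blast

lemma fillings_column:
  assumes "f \<in> fillings k m" "j < m"
  obtains i where "i < k" "f (i, j) = 1"
  using assms by (auto simp: fillings_def)

lemma fillings_values:
  assumes "f \<in> fillings k m" "i < k" "j < m"
  shows "f (i, j) \<in> {0, 1, 2}"
  using assms by (simp add: fillings_def)

lemma downclosed_eq_lessThan_card:
  fixes A :: "nat set"
  assumes "finite A" and down: "\<And>x y. y \<in> A \<Longrightarrow> x \<le> y \<Longrightarrow> x \<in> A"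
  shows "A = {..<card A}"
proof (cases "A = {}")
  case False
  then have "A = {..Max A}" using assms by (auto intro: Max_in down)
  then show ?thesis by (metis card_atMost lessThan_Suc_atMost)
qed simp

lemma young_diagram_eq:
  assumes "(lam, f) \<in> permutation_tableaux k m"
  shows "young_diagram lam = {b \<in> rect k m. f b \<noteq> 2}"
proof -
  have lam: "length lam = k" "\<forall>x\<in>set lam. x \<le> m"
    and vals: "\<forall>b\<in>young_diagram lam. f b \<in> {0, 1}"
      "\<forall>b\<in>rect k m - young_diagram lam. f b = 2"
    using assms by (simp_all add: permutation_tableaux_def partition_in_rect_def)
  have "b \<in> rect k m" if "b \<in> young_diagram lam" for b
  proof -
    obtain i j where b: "b = (i, j)" by force
    then have "i < k" "j < lam ! i"
      using that lam(1) by (simp_all add: young_diagram_def)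
    moreover from this have "lam ! i \<le> m" using lam by simp
    ultimately show ?thesis using b by (simp add: rect_def)
  qed
  then show ?thesis using vals by fastforce
qed

text \<open>The partition is recovered from the filling by counting the entries other than 2 in each
  row. Closure of the 2's to the right makes these entries an initial segment of the row, and
  closure downwards makes the row lengths weakly decreasing.\<close>

lemma bij_betw_tableaux_fillings:
  "bij_betw snd (permutation_tableaux k m) (fillings k m)"
proof (rule bij_betw_imageI)
  show "inj_on snd (permutation_tableaux k m)"
  proof (clarsimp simp: inj_on_def)
    fix lam lam' f
    assume T: "(lam, f) \<in> permutation_tableaux k m" "(lam', f) \<in> permutation_tableaux k m"
    then have len: "length lam = k" "length lam' = k"
      by (auto simp: permutation_tableaux_def partition_in_rect_def)
    have "young_diagram lam = young_diagram lam'"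
      using T by (simp add: young_diagram_eq)
    then have "(i, j) \<in> young_diagram lam \<longleftrightarrow> (i, j) \<in> young_diagram lam'" for i j
      by simp
    then have "lam ! i = lam' ! i" if "i < k" for i
      using that len by (auto simp: young_diagram_def) (metis linorder_neqE_nat nat_less_le)
    then show "lam = lam'" using len by (auto intro: nth_equalityI)
  qed
  show "snd ` permutation_tableaux k m = fillings k m" (is "?L = ?R")
  proof
    show "?L \<subseteq> ?R"
    proof (clarify, simp)
      fix lam f assume T: "(lam, f) \<in> permutation_tableaux k m"
      then have lam: "length lam = k" "sorted_wrt (\<ge>) lam"
        by (auto simp: permutation_tableaux_def partition_in_rect_def)
      note Y = young_diagram_eq[OF T]
      have mono: "lam ! i' \<le> lam ! i" if "i \<le> i'" "i' < k" for i i'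
        using that lam sorted_wrt_nth_less[of "(\<ge>)" lam i i'] by (cases "i = i'") auto
      have two: "f (i, j) = 2 \<longleftrightarrow> \<not> j < lam ! i" if "i < k" "j < m" for i j
      proof -
        have "(i, j) \<in> young_diagram lam \<longleftrightarrow> (i, j) \<in> {b \<in> rect k m. f b \<noteq> 2}"
          by (simp only: Y)
        then show ?thesis using that lam by (simp add: young_diagram_def rect_def)
      qed
      have "f (i, j) \<in> {0, 1, 2}" if "i < k" "j < m" for i j
        using T that by (cases "(i, j) \<in> young_diagram lam")
          (auto simp: permutation_tableaux_def rect_def)
      moreover have "f (i', j') = 2"
        if "i' < k" "j' < m" "i \<le> i'" "j \<le> j'" "f (i, j) = 2" for i j i' j'
        using that two[of i j] two[of i' j'] mono[of i i'] by simp
      moreover have "f (i, j') \<noteq> 1"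
        if "i < k" "j < m" "f (i, j) = 0" "i' < i" "f (i', j) = 1" "j' < j" for i j i' j'
      proof -
        have "(i, j) \<in> young_diagram lam" using that by (simp add: Y rect_def)
        then show ?thesis using T that unfolding permutation_tableaux_def by blast
      qed
      moreover have "f \<in> extensional (rect k m)" "\<forall>j<m. \<exists>i<k. f (i, j) = 1"
        using T by (simp_all add: permutation_tableaux_def)
      ultimately show "f \<in> fillings k m"
        unfolding fillings_def by blast
    qed
    show "?R \<subseteq> ?L"
    proof
      fix f assume f: "f \<in> fillings k m"
      define row where "row = (\<lambda>i. {j. j < m \<and> f (i, j) \<noteq> 2})"
      define lam where "lam = map (\<lambda>i. card (row i)) [0..<k]"
      have row: "row i = {..<card (row i)}" if "i < k" for i
        by (rule downclosed_eq_lessThan_card)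
           (use fillings_two_mono[OF f that _ order_refl] in \<open>auto simp: row_def\<close>)
      have Y: "young_diagram lam = {b \<in> rect k m. f b \<noteq> 2}"
      proof -
        have "j < card (row i) \<longleftrightarrow> j < m \<and> f (i, j) \<noteq> 2" if "i < k" for i j
          using row[OF that] by (auto simp: row_def)
        then show ?thesis by (auto simp: young_diagram_def lam_def rect_def)
      qed
      have mono: "card (row i') \<le> card (row i)" if "i \<le> i'" "i' < k" for i i'
        by (intro card_mono) (use fillings_two_mono[OF f that(2) _ that(1)] in \<open>auto simp: row_def\<close>)
      have "card (row i) \<le> m" for i
        using card_mono[of "{..<m}" "row i"] by (auto simp: row_def)
      then have "partition_in_rect k m lam"
        by (auto simp: partition_in_rect_def lam_def sorted_wrt_iff_nth_less intro: mono)
      moreover have "\<forall>b\<in>{b \<in> rect k m. f b \<noteq> 2}. f b \<in> {0, 1}"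
        using f by (auto simp: fillings_def rect_def)
      moreover have "\<not> (\<exists>i j i' j'. (i, j) \<in> {b \<in> rect k m. f b \<noteq> 2} \<and> f (i, j) = 0 \<and>
            i' < i \<and> f (i', j) = 1 \<and> j' < j \<and> f (i, j') = 1)"
        using fillings_zero[OF f] unfolding rect_def by blast
      moreover have "f \<in> extensional (rect k m)" "\<forall>j<m. \<exists>i<k. f (i, j) = 1"
        using f by (simp_all add: fillings_def)
      moreover have "\<forall>b\<in>rect k m - {b \<in> rect k m. f b \<noteq> 2}. f b = 2" by blast
      ultimately have "(lam, f) \<in> permutation_tableaux k m"
        unfolding permutation_tableaux_def mem_Collect_eq case_prod_conv Y by blast
      then show "f \<in> ?L" by force
    qed
  qed
qed

lemma finite_fillings [simp]: "finite (fillings k m)"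
  using bij_betw_finite[OF bij_betw_tableaux_fillings] finite_permutation_tableaux by blast

section \<open>Free rows and the weighted generating function\<close>

definition free_rows :: "nat \<Rightarrow> nat \<Rightarrow> (nat \<times> nat \<Rightarrow> nat) \<Rightarrow> nat set" where
  "free_rows k m f = {i. i < k \<and> (\<forall>j<m. f (i, j) = 0 \<longrightarrow> (\<forall>i'<i. f (i', j) \<noteq> 1))}"

text \<open>Weighting a free row by \<open>x = p\<^sup>-\<^sup>t [t + 1]\<close> makes the substitution \<open>x \<mapsto> 1 + x / p\<close> coming from a
  new first column the shift \<open>t \<mapsto> t + 1\<close>; the factor \<open>p\<^sup>t\<^sup>k\<close> clears the denominators.\<close>

definition row_sum :: "'a::comm_ring_1 \<Rightarrow> nat \<Rightarrow> nat \<Rightarrow> nat \<Rightarrow> 'a" where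
  "row_sum p t k m = (\<Sum>f\<in>fillings k m.
     p ^ (num_entries k m 0 f + t * (k - card (free_rows k m f))) *
     q_nat p (Suc t) ^ card (free_rows k m f))"

text \<open>At \<open>t = 0\<close> a free row has weight \<open>[1] = 1\<close> and the exponent
  \<open>t * (k - u)\<close> vanishes, so only the zeros are counted.\<close>

lemma D_tab_eq_row_sum: "D_tab k n p 1 1 = row_sum p 0 k (n - k)"
  unfolding D_tab_def row_sum_def
  by (subst sum.reindex_bij_betw[OF bij_betw_tableaux_fillings, symmetric])
     (simp add: case_prod_unfold)

lemma row_sum_no_columns: "row_sum p t k 0 = q_nat p (Suc t) ^ k"
proof -
  have "fillings k 0 = {\<lambda>_. undefined}"
    by (auto simp: fillings_def rect_def)
  then show ?thesis
    by (simp add: row_sum_def num_entries_def rect_def free_rows_def)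
qed

lemma row_sum_no_rows: "row_sum p t 0 (Suc m) = 0"
proof -
  have "fillings 0 (Suc m) = {}" by (auto simp: fillings_def)
  then show ?thesis by (simp add: row_sum_def)
qed

subsection \<open>Removing an empty last row\<close>

lemma fillings_last_row_empty:
  assumes f: "f \<in> fillings (Suc k) m" and "0 < m" "f (k, 0) = 2" "j < m"
  shows "f (k, j) = 2"
  using fillings_two_mono[OF f, of k j k 0] assms by simp

text \<open>A row of 2's contains no zero and is free. Deleting it preserves the number of zeros and
  of rows that are not free, and costs one factor \<open>[t + 1]\<close>. Since \<open>m\<close> is
  positive, the entry at \<open>(k, 0)\<close> detects such a row.\<close>

lemma row_sum_last_row_empty:
  assumes m: "0 < m"
  shows "(\<Sum>f | f \<in> fillings (Suc k) m \<and> f (k, 0) = 2.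
      p ^ (num_entries (Suc k) m 0 f + t * (Suc k - card (free_rows (Suc k) m f))) *
      q_nat p (Suc t) ^ card (free_rows (Suc k) m f)) =
    q_nat p (Suc t) * row_sum p t k m"
proof -
  \<comment> \<open>\<open>cut\<close> deletes the last row and \<open>ext\<close> appends a row of
    2's; they are the two directions of the bijection.\<close>
  define cut where "cut f = restrict f (rect k m)" for f :: "nat \<times> nat \<Rightarrow> nat"
  define ext where
    "ext g = restrict (\<lambda>(i, j). if i = k then 2 else g (i, j)) (rect (Suc k) m)"
    for g :: "nat \<times> nat \<Rightarrow> nat"
  have cut: "cut f (i, j) = f (i, j)" if "i < k" "j < m" for f i j
    using that by (simp add: cut_def rect_def)
  have ext: "ext g (i, j) = g (i, j)" if "i < k" "j < m" for g i j
    using that by (simp add: ext_def rect_def)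
  have ext_k: "ext g (k, j) = 2" if "j < m" for g j
    using that by (simp add: ext_def rect_def)
  have cut_ext: "cut (ext g) = g" if "g \<in> fillings k m" for g
  proof (rule extensionalityI)
    show "g \<in> extensional (rect k m)" using that by (simp add: fillings_def)
  qed (auto simp: cut_def ext rect_def)
  have ext_cut: "ext (cut f) = f" if f: "f \<in> fillings (Suc k) m" "f (k, 0) = 2" for f
  proof (rule extensionalityI)
    show "f \<in> extensional (rect (Suc k) m)" using f by (simp add: fillings_def)
    show "ext (cut f) b = f b" if "b \<in> rect (Suc k) m" for b
    proof -
      obtain i j where b: "b = (i, j)" by force
      with that have "i < Suc k" "j < m" by (auto simp: rect_def)
      then show ?thesis
        using fillings_last_row_empty[OF f(1) m f(2)]
        by (cases "i = k") (simp_all add: b ext ext_k cut)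
    qed
  qed (simp add: ext_def)
  have cut_in: "cut f \<in> fillings k m" if f: "f \<in> fillings (Suc k) m" "f (k, 0) = 2" for f
  proof (rule fillingsI)
    fix j assume j: "j < m"
    obtain i where i: "i < Suc k" "f (i, j) = 1" by (rule fillings_column[OF f(1) j])
    then have "i \<noteq> k" using fillings_last_row_empty[OF f(1) m f(2) j] by auto
    then show "\<exists>i<k. cut f (i, j) = 1" using i j by (intro exI[of _ i]) (simp add: cut)
  next
    fix i j assume "i < k" "j < m"
    then show "cut f (i, j) \<in> {0, 1, 2}"
      unfolding cut[OF \<open>i < k\<close> \<open>j < m\<close>] by (intro fillings_values[OF f(1)]) auto
  next
    fix i j i' j' assume *: "i' < k" "j' < m" "i \<le> i'" "j \<le> j'" "cut f (i, j) = 2"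
    then show "cut f (i', j') = 2"
      using fillings_two_mono[OF f(1), of i' j' i j] by (simp add: cut)
  next
    fix i j i' j'
    assume *: "i < k" "j < m" "cut f (i, j) = 0" "i' < i" "cut f (i', j) = 1" "j' < j"
    then show "cut f (i, j') \<noteq> 1"
      using fillings_zero[OF f(1), of i j i' j'] by (simp add: cut)
  qed (simp add: cut_def)
  have ext_in: "ext g \<in> fillings (Suc k) m" if g: "g \<in> fillings k m" for g
  proof (rule fillingsI)
    fix j assume j: "j < m"
    obtain i where i: "i < k" "g (i, j) = 1" by (rule fillings_column[OF g j])
    then show "\<exists>i<Suc k. ext g (i, j) = 1" using j by (intro exI[of _ i]) (simp add: ext)
  next
    fix i j assume "i < Suc k" "j < m"
    then show "ext g (i, j) \<in> {0, 1, 2}"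
      using fillings_values[OF g, of i j] by (cases "i = k") (simp_all add: ext ext_k)
  next
    fix i j i' j' assume *: "i' < Suc k" "j' < m" "i \<le> i'" "j \<le> j'" "ext g (i, j) = 2"
    then show "ext g (i', j') = 2"
      using fillings_two_mono[OF g, of i' j' i j] by (cases "i' = k") (simp_all add: ext ext_k)
  next
    fix i j i' j'
    assume *: "i < Suc k" "j < m" "ext g (i, j) = 0" "i' < i" "ext g (i', j) = 1" "j' < j"
    then have "i \<noteq> k" using ext_k[of j g] by auto
    then show "ext g (i, j') \<noteq> 1"
      using * fillings_zero[OF g, of i j i' j'] by (simp add: ext)
  qed (simp add: ext_def)
  show ?thesis
    unfolding row_sum_def sum_distrib_left
  proof (rule sum.reindex_bij_witness[of _ ext cut])
    fix f assume "f \<in> {f. f \<in> fillings (Suc k) m \<and> f (k, 0) = 2}"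
    then have f: "f \<in> fillings (Suc k) m" "f (k, 0) = 2" by auto
    note last = fillings_last_row_empty[OF f(1) m f(2)]
    show "ext (cut f) = f" "cut f \<in> fillings k m"
      using f by (simp_all add: ext_cut cut_in)
    have "{b \<in> rect (Suc k) m. f b = 0} = {b \<in> rect k m. cut f b = 0}"
      using last by (auto simp: rect_def less_Suc_eq cut)
    then have z: "num_entries (Suc k) m 0 f = num_entries k m 0 (cut f)"
      by (simp add: num_entries_def)
    have "free_rows (Suc k) m f = insert k (free_rows k m (cut f))"
      using last by (auto simp: free_rows_def cut less_Suc_eq)
    then have c: "card (free_rows (Suc k) m f) = Suc (card (free_rows k m (cut f)))"
      by (simp add: free_rows_def)
    show "q_nat p (Suc t) *
        (p ^ (num_entries k m 0 (cut f) + t * (k - card (free_rows k m (cut f)))) *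
         q_nat p (Suc t) ^ card (free_rows k m (cut f))) =
      p ^ (num_entries (Suc k) m 0 f + t * (Suc k - card (free_rows (Suc k) m f))) *
        q_nat p (Suc t) ^ card (free_rows (Suc k) m f)"
      by (simp add: z c mult.left_commute)
  next
    fix g assume g: "g \<in> fillings k m"
    show "cut (ext g) = g" by (rule cut_ext[OF g])
    show "ext g \<in> {f. f \<in> fillings (Suc k) m \<and> f (k, 0) = 2}"
      using ext_in[OF g] ext_k[OF m] by simp
  qed
qed

subsection \<open>Removing a full first column\<close>

text \<open>The free rows that stay free under a new first column with ones in the rows \<open>S\<close>.\<close>

definition kept_rows :: "nat set \<Rightarrow> nat set \<Rightarrow> nat set" where
  "kept_rows U S = {i \<in> U. i \<in> S \<or> (\<forall>i'\<in>S. i \<le> i')}"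

text \<open>\<open>S\<close> is the set of ones in a new first column. A row of \<open>U\<close> has
  weight \<open>y\<close> if it is in \<open>S\<close>, \<open>b\<close> if it gets a zero above the
  topmost 1 and stays free, and \<open>c\<close> if it gets a zero below that 1. Adding a row
  \<open>M\<close> below all others multiplies the old sum by \<open>y + c\<close>; the new set
  \<open>{M}\<close> adds \<open>y * b ^ card U\<close>.\<close>

lemma sum_first_columns:
  fixes y b c :: "'a::comm_ring_1"
  assumes "finite U" and rel: "y + c = 1 + b"
  shows "(\<Sum>S\<in>Pow U - {{}}. y ^ card S * b ^ card (kept_rows U S - S) * c ^ card (U - kept_rows U S))
    = y * ((y + c) ^ card U - b ^ card U)"
  using assms(1)
proof (induction U rule: finite_linorder_max_induct)
  case empty
  then show ?case by simp
next
  case (insert M U)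
  let ?w = "\<lambda>U S. y ^ card S * b ^ card (kept_rows U S - S) * c ^ card (U - kept_rows U S)"
  let ?P = "Pow U - {{}}"
  have M: "M \<notin> U" using insert by auto
  have "Pow (insert M U) - {{}} = ?P \<union> insert M ` ?P \<union> {{M}}"
    by (auto simp: Pow_insert)
  moreover have "?P \<inter> insert M ` ?P = {}" "(?P \<union> insert M ` ?P) \<inter> {{M}} = {}"
    using M by (auto simp: insert_ident) 
  ultimately have "sum (?w (insert M U)) (Pow (insert M U) - {{}}) =
      sum (?w (insert M U)) ?P + sum (?w (insert M U)) (insert M ` ?P) + ?w (insert M U) {M}"
    using insert.hyps(1) by (simp add: sum.union_disjoint)
  also have "sum (?w (insert M U)) ?P = c * sum (?w U) ?P"
    unfolding sum_distrib_left
  proof (rule sum.cong)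
    fix S assume S: "S \<in> ?P"
    then have K: "kept_rows (insert M U) S = kept_rows U S"
      using insert.hyps(2) M by (fastforce simp: kept_rows_def)
    have "insert M U - kept_rows U S = insert M (U - kept_rows U S)"
      using M by (auto simp: kept_rows_def)
    then show "?w (insert M U) S = c * ?w U S"
      using insert.hyps(1) M by (simp add: K algebra_simps)
  qed simp
  also have "sum (?w (insert M U)) (insert M ` ?P) = sum (\<lambda>S. ?w (insert M U) (insert M S)) ?P"
    using M by (subst sum.reindex) (auto simp: inj_on_def insert_ident)
  also have "\<dots> = y * sum (?w U) ?P"
    unfolding sum_distrib_left
  proof (rule sum.cong)
    fix S assume S: "S \<in> ?P"
    then have fS: "finite S" and MS: "M \<notin> S"
      using insert.hyps(1) M by (auto intro: finite_subset)
    have K: "kept_rows (insert M U) (insert M S) = insert M (kept_rows U S)"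
      using insert.hyps(2) by (fastforce simp: kept_rows_def)
    have "insert M (kept_rows U S) - insert M S = kept_rows U S - S"
      "insert M U - insert M (kept_rows U S) = U - kept_rows U S"
      using M S by (auto simp: kept_rows_def)
    then show "?w (insert M U) (insert M S) = y * ?w U S"
      using fS MS by (simp add: K algebra_simps)
  qed simp
  also have "?w (insert M U) {M} = y * b ^ card U"
  proof -
    have "kept_rows (insert M U) {M} = insert M U"
      using insert.hyps(2) by (force simp: kept_rows_def)
    then show ?thesis using M by simp
  qed
  finally have "sum (?w (insert M U)) (Pow (insert M U) - {{}}) =
      (y + c) * (y * ((y + c) ^ card U - b ^ card U)) + y * b ^ card U"
    unfolding insert.IH by (simp add: algebra_simps)
  also have "\<dots> = y * ((y + c) ^ Suc (card U) - b ^ Suc (card U))"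
  proof -
    \<comment> \<open>Here \<open>rel\<close> enters: the recurrence would produce the denominator
      \<open>y + c - b\<close>, which is 1.\<close>
    have "(y + c) * (y * (X - Y)) + y * Y = y * ((y + c) * X - b * Y)" for X Y
      unfolding rel by (simp add: algebra_simps)
    then show ?thesis by simp
  qed
  finally show ?case using insert.hyps(1) M by simp
qed

definition tail_columns :: "nat \<Rightarrow> nat \<Rightarrow> (nat \<times> nat \<Rightarrow> nat) \<Rightarrow> nat \<times> nat \<Rightarrow> nat" where
  "tail_columns k m f = restrict (\<lambda>(i, j). f (i, Suc j)) (rect k m)"

definition cons_column :: "nat \<Rightarrow> nat \<Rightarrow> nat set \<Rightarrow> (nat \<times> nat \<Rightarrow> nat) \<Rightarrow> nat \<times> nat \<Rightarrow> nat" where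
  "cons_column k m S g = restrict
     (\<lambda>(i, j). if j = 0 then (if i \<in> S then 1 else 0) else g (i, j - 1)) (rect k (Suc m))"

lemma tail_columns_apply [simp]:
  "i < k \<Longrightarrow> j < m \<Longrightarrow> tail_columns k m f (i, j) = f (i, Suc j)"
  by (simp add: tail_columns_def rect_def)

lemma cons_column_apply [simp]:
  "i < k \<Longrightarrow> cons_column k m S g (i, 0) = (if i \<in> S then 1 else 0)"
  "i < k \<Longrightarrow> j < m \<Longrightarrow> cons_column k m S g (i, Suc j) = g (i, j)"
  by (simp_all add: cons_column_def rect_def)

lemma tail_cons_column:
  assumes "g \<in> extensional (rect k m)"
  shows "tail_columns k m (cons_column k m S g) = g"
proof
  fix b :: "nat \<times> nat"
  obtain i j where "b = (i, j)" by force
  then show "tail_columns k m (cons_column k m S g) b = g b"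
    using assms by (cases "i < k \<and> j < m")
      (auto simp: tail_columns_def[of k m "cons_column k m S g"] rect_def extensional_def)
qed

text \<open>The first column must be free of 2's, because \<open>cons_column\<close> writes 0 in
  every row outside \<open>S\<close>.\<close>

lemma cons_tail_column:
  assumes "f \<in> extensional (rect k (Suc m))" "\<And>i. i < k \<Longrightarrow> f (i, 0) \<in> {0, 1}"
  shows "cons_column k m {i. i < k \<and> f (i, 0) = 1} (tail_columns k m f) = f"
proof
  fix b :: "nat \<times> nat"
  obtain i j where b: "b = (i, j)" by force
  show "cons_column k m {i. i < k \<and> f (i, 0) = 1} (tail_columns k m f) b = f b"
  proof (cases "i < k \<and> j < Suc m")
    case True
    then show ?thesis using b assms(2)[of i] by (cases j) auto
  next
    case False
    then have "b \<notin> rect k (Suc m)" using b by (simp add: rect_def)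
    then show ?thesis using extensional_arb[OF assms(1)] by (simp add: cons_column_def)
  qed
qed

text \<open>The conditions are compared one by one. The new column contains no 2, so the shape
  condition is inherited; having a 1 in it means that \<open>S\<close> is nonempty. A zero in it has
  nothing to its left, while a 1 in row \<open>i\<close> forbids every zero of that row with a 1
  above it, which says that row \<open>i\<close> is free.\<close>

lemma cons_column_in_fillings_iff:
  assumes S: "S \<subseteq> {..<k}" and ext: "g \<in> extensional (rect k m)"
  shows "cons_column k m S g \<in> fillings k (Suc m) \<longleftrightarrow>
    g \<in> fillings k m \<and> S \<subseteq> free_rows k m g \<and> S \<noteq> {}"
    (is "?f \<in> _ \<longleftrightarrow> _")
proof -
  have "?f \<in> extensional (rect k (Suc m))" by (simp add: cons_column_def)
  moreover have "(\<forall>i<k. \<forall>j<Suc m. ?f (i, j) \<in> {0, 1, 2}) \<longleftrightarrow> (\<forall>i<k. \<forall>j<m. g (i, j) \<in> {0, 1, 2})"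
    by (auto simp: All_less_Suc2)
  moreover have "(\<forall>i'<k. \<forall>j'<Suc m. \<forall>i\<le>i'. \<forall>j\<le>j'. ?f (i, j) = 2 \<longrightarrow> ?f (i', j') = 2) \<longleftrightarrow>
      (\<forall>i'<k. \<forall>j'<m. \<forall>i\<le>i'. \<forall>j\<le>j'. g (i, j) = 2 \<longrightarrow> g (i', j') = 2)" (is "?l \<longleftrightarrow> ?r")
  proof
    assume l: ?l
    show ?r
    proof (intro allI impI)
      fix i' j' i j assume *: "i' < k" "j' < m" "i \<le> i'" "j \<le> j'" "g (i, j) = 2"
      then have "?f (i, Suc j) = 2" by simp
      then have "?f (i', Suc j') = 2" using l * by (metis Suc_le_mono Suc_mono)
      then show "g (i', j') = 2" using * by simp
    qed
  next
    assume r: ?r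
    show ?l
    proof (intro allI impI)
      fix i' j' i j
      assume *: "i' < k" "j' < Suc m" "i \<le> i'" "j \<le> j'" "?f (i, j) = 2"
      then obtain l where l: "j = Suc l" by (cases j) (auto split: if_splits)
      with * obtain l' where l': "j' = Suc l'" by (cases j') auto
      show "?f (i', j') = 2" using * r l l' by auto
    qed
  qed
  moreover have "(\<forall>j<Suc m. \<exists>i<k. ?f (i, j) = 1) \<longleftrightarrow> S \<noteq> {} \<and> (\<forall>j<m. \<exists>i<k. g (i, j) = 1)"
    using S by (auto simp: All_less_Suc2 subset_iff cong: conj_cong)
  moreover have "(\<forall>i<k. \<forall>j<Suc m. ?f (i, j) = 0 \<longrightarrow> (\<exists>i'<i. ?f (i', j) = 1) \<longrightarrow>
        (\<forall>j'<j. ?f (i, j') \<noteq> 1)) \<longleftrightarrow>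
      (\<forall>i<k. \<forall>j<m. g (i, j) = 0 \<longrightarrow> (\<exists>i'<i. g (i', j) = 1) \<longrightarrow> (\<forall>j'<j. g (i, j') \<noteq> 1)) \<and>
      S \<subseteq> free_rows k m g"
  proof -
    have row: "(\<forall>j<Suc m. ?f (i, j) = 0 \<longrightarrow> (\<exists>i'<i. ?f (i', j) = 1) \<longrightarrow> (\<forall>j'<j. ?f (i, j') \<noteq> 1)) \<longleftrightarrow>
      (\<forall>j<m. g (i, j) = 0 \<longrightarrow> (\<exists>i'<i. g (i', j) = 1) \<longrightarrow> i \<notin> S \<and> (\<forall>j'<j. g (i, j') \<noteq> 1))"
      if "i < k" for i
      using that by (auto simp: All_less_Suc2)
    have "(\<forall>i<k. \<forall>j<Suc m. ?f (i, j) = 0 \<longrightarrow> (\<exists>i'<i. ?f (i', j) = 1) \<longrightarrow>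
        (\<forall>j'<j. ?f (i, j') \<noteq> 1)) \<longleftrightarrow>
      (\<forall>i<k. \<forall>j<m. g (i, j) = 0 \<longrightarrow> (\<exists>i'<i. g (i', j) = 1) \<longrightarrow>
        i \<notin> S \<and> (\<forall>j'<j. g (i, j') \<noteq> 1))"
      by (rule iff_allI, rule imp_cong, rule refl, rule row)
    moreover have "S \<subseteq> free_rows k m g \<longleftrightarrow>
        (\<forall>i<k. \<forall>j<m. g (i, j) = 0 \<longrightarrow> (\<exists>i'<i. g (i', j) = 1) \<longrightarrow> i \<notin> S)"
      using S by (fastforce simp: free_rows_def)
    ultimately show ?thesis by blast
  qed
  ultimately have "?f \<in> fillings k (Suc m) \<longleftrightarrow>
      (\<forall>i<k. \<forall>j<m. g (i, j) \<in> {0, 1, 2}) \<and>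
      (\<forall>i'<k. \<forall>j'<m. \<forall>i\<le>i'. \<forall>j\<le>j'. g (i, j) = 2 \<longrightarrow> g (i', j') = 2) \<and>
      (S \<noteq> {} \<and> (\<forall>j<m. \<exists>i<k. g (i, j) = 1)) \<and>
      ((\<forall>i<k. \<forall>j<m. g (i, j) = 0 \<longrightarrow> (\<exists>i'<i. g (i', j) = 1) \<longrightarrow> (\<forall>j'<j. g (i, j') \<noteq> 1)) \<and>
      S \<subseteq> free_rows k m g)"
    unfolding fillings_def mem_Collect_eq by (simp only: simp_thms)
  then show ?thesis
    unfolding fillings_def mem_Collect_eq using ext by (simp only: simp_thms conj_ac)
qed

text \<open>The only new obstruction to being free is a zero in the new column with a 1 above it,
  that is, a row outside \<open>S\<close> below some element of \<open>S\<close>.\<close>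

lemma free_rows_cons_column:
  assumes "S \<subseteq> free_rows k m g"
  shows "free_rows k (Suc m) (cons_column k m S g) = kept_rows (free_rows k m g) S"
proof -
  have "i \<in> free_rows k (Suc m) (cons_column k m S g) \<longleftrightarrow>
      i \<in> free_rows k m g \<and> (i \<notin> S \<longrightarrow> (\<forall>i'<i. i' \<notin> S))" for i
    by (auto simp: free_rows_def All_less_Suc2)
  then show ?thesis using assms by (fastforce simp: kept_rows_def not_less)
qed

lemma num_entries_cons_column:
  assumes "S \<subseteq> {..<k}"
  shows "num_entries k (Suc m) 0 (cons_column k m S g) = num_entries k m 0 g + (k - card S)"
proof -
  let ?A = "(\<lambda>i. (i, 0::nat)) ` ({..<k} - S)"
  let ?B = "(\<lambda>(i, j). (i, Suc j)) ` {b \<in> rect k m. g b = 0}"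
  have fin: "finite {b \<in> rect k m. g b = 0}" by (simp add: rect_def)
  have "{b \<in> rect k (Suc m). cons_column k m S g b = 0} = ?A \<union> ?B"
  proof (rule set_eqI)
    fix b :: "nat \<times> nat"
    obtain i j where b: "b = (i, j)" by force
    show "b \<in> {b \<in> rect k (Suc m). cons_column k m S g b = 0} \<longleftrightarrow> b \<in> ?A \<union> ?B"
      unfolding b by (cases j) (auto simp: rect_def image_iff)
  qed
  moreover have "card (?A \<union> ?B) = card ?A + card ?B"
    using fin by (intro card_Un_disjoint) auto
  moreover have "card ?A = k - card S"
    using assms by (subst card_image) (auto simp: inj_on_def card_Diff_subset finite_subset)
  moreover have "card ?B = num_entries k m 0 g"
    unfolding num_entries_def by (intro card_image) (auto simp: inj_on_def)
  ultimately show ?thesis by (simp add: num_entries_def)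
qed

lemma fillings_first_column_full:
  assumes "f \<in> fillings (Suc k) (Suc m)" "f (k, 0) \<noteq> 2" "i < Suc k"
  shows "f (i, 0) \<in> {0, 1}"
proof -
  have "f (i, 0) \<in> {0, 1, 2}"
    by (rule fillings_values[OF assms(1,3)]) simp
  moreover have "f (i, 0) = 2 \<Longrightarrow> f (k, 0) = 2"
    by (rule fillings_two_mono[OF assms(1)]) (use assms(3) in auto)
  ultimately show ?thesis using assms(2) by blast
qed

text \<open>For a fixed remainder \<open>g\<close>, a free row with a 1 in the new column
  contributes \<open>[t + 1]\<close>, one that stays free with a zero \<open>p [t + 1]\<close>, and
  one that ceases to be free \<open>p^(t + 1)\<close>. Every other row receives a zero, raising its
  weight from \<open>p^t\<close> to \<open>p^(t + 1)\<close>. As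
  \<open>[t + 1] + p^(t + 1) = [t + 2]\<close>, \<open>sum_first_columns\<close> yields the weights
  for \<open>t + 1\<close> and, from the subtracted power, those for \<open>t\<close>.\<close>

lemma row_sum_first_column_full:
  fixes p :: "'a::comm_ring_1"
  shows "(\<Sum>f | f \<in> fillings (Suc k) (Suc m) \<and> f (k, 0) \<noteq> 2.
      p ^ (num_entries (Suc k) (Suc m) 0 f + t * (Suc k - card (free_rows (Suc k) (Suc m) f))) *
      q_nat p (Suc t) ^ card (free_rows (Suc k) (Suc m) f)) =
    q_nat p (Suc t) * (row_sum p (Suc t) (Suc k) m - p ^ Suc k * row_sum p t (Suc k) m)"
    (is "sum ?F ?B = _")
proof -
  let ?K = "Suc k"
  let ?y = "q_nat p (Suc t)"
  let ?U = "free_rows ?K m"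
  let ?z = "num_entries ?K m 0"
  let ?W = "\<lambda>(g, S). ?F (cons_column ?K m S g)"
  have U: "finite (?U g)" "?U g \<subseteq> {..<?K}" "card (?U g) \<le> ?K" for g
  proof -
    show "?U g \<subseteq> {..<?K}" by (auto simp: free_rows_def)
    then show "finite (?U g)" "card (?U g) \<le> ?K"
      using finite_subset card_mono[of "{..<?K}" "?U g"] by auto
  qed
  have "sum ?F ?B = sum ?W (SIGMA g:fillings ?K m. Pow (?U g) - {{}})"
  proof (rule sum.reindex_bij_witness[of _ "\<lambda>(g, S). cons_column ?K m S g"
        "\<lambda>f. (tail_columns ?K m f, {i. i < ?K \<and> f (i, 0) = 1})"])
    fix f assume "f \<in> ?B"
    then have f: "f \<in> fillings ?K (Suc m)" "f (k, 0) \<noteq> 2" by auto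
    let ?g = "tail_columns ?K m f" and ?S = "{i. i < ?K \<and> f (i, 0) = 1}"
    have c: "cons_column ?K m ?S ?g = f"
      by (rule cons_tail_column)
         (use f fillings_first_column_full[OF f] in \<open>auto simp: fillings_def\<close>)
    then show "(case (?g, ?S) of (g, S) \<Rightarrow> cons_column ?K m S g) = f" by simp
    have "?g \<in> extensional (rect ?K m)" by (simp add: tail_columns_def)
    then show "(?g, ?S) \<in> (SIGMA g:fillings ?K m. Pow (?U g) - {{}})"
      using cons_column_in_fillings_iff[of ?S ?K ?g m] f(1) c by auto
    show "?W (?g, ?S) = ?F f" using c by simp
  next
    fix x assume "x \<in> (SIGMA g:fillings ?K m. Pow (?U g) - {{}})"
    then obtain g S where x: "x = (g, S)" and g: "g \<in> fillings ?K m"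
      and S: "S \<subseteq> ?U g" "S \<noteq> {}" by auto
    have SK: "S \<subseteq> {..<?K}" using S U(2) by blast
    have ext: "g \<in> extensional (rect ?K m)" using g by (simp add: fillings_def)
    have "{i. i < ?K \<and> cons_column ?K m S g (i, 0) = 1} = S"
      using SK by (auto split: if_splits)
    then show "(tail_columns ?K m (case x of (g, S) \<Rightarrow> cons_column ?K m S g),
        {i. i < ?K \<and> (case x of (g, S) \<Rightarrow> cons_column ?K m S g) (i, 0) = 1}) = x"
      using x tail_cons_column[OF ext] by simp
    show "(case x of (g, S) \<Rightarrow> cons_column ?K m S g) \<in> ?B"
      using cons_column_in_fillings_iff[OF SK ext] g S x by simp
  qed
  also have "\<dots> = (\<Sum>g\<in>fillings ?K m. \<Sum>S\<in>Pow (?U g) - {{}}. ?F (cons_column ?K m S g))"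
    by (subst sum.Sigma) (auto simp: U)
  also have "\<dots> = (\<Sum>g\<in>fillings ?K m.
      ?y * (p ^ (?z g + Suc t * (?K - card (?U g))) * q_nat p (Suc (Suc t)) ^ card (?U g) -
        p ^ ?K * (p ^ (?z g + t * (?K - card (?U g))) * ?y ^ card (?U g))))"
  proof (rule sum.cong)
    fix g assume "g \<in> fillings ?K m"
    let ?u = "card (?U g)" and ?c = "p ^ Suc t"
    let ?V = "kept_rows (?U g)"
    have "?F (cons_column ?K m S g) = p ^ (?z g + Suc t * (?K - ?u)) *
        (?y ^ card S * (p * ?y) ^ card (?V S - S) * ?c ^ card (?U g - ?V S))"
      if S: "S \<subseteq> ?U g" for S
    proof -
      have SK: "S \<subseteq> {..<?K}" using S U(2) by blast
      have sub: "S \<subseteq> ?V S" "?V S \<subseteq> ?U g" using S by (auto simp: kept_rows_def)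
      have fin: "finite S" "finite (?V S)" using sub U(1) by (meson finite_subset)+
      \<comment> \<open>The rows are split into \<open>card S\<close> rows with a 1,
        \<open>a\<close> free rows kept with a zero, \<open>d\<close> free rows lost, and
        \<open>e\<close> rows that were not free before.\<close>
      obtain a where a: "card (?V S) = card S + a" "card (?V S - S) = a"
        using sub fin by (metis card_Diff_subset card_mono le_add_diff_inverse)
      obtain d where d: "?u = card (?V S) + d" "card (?U g - ?V S) = d"
        using sub fin U(1) by (metis card_Diff_subset card_mono le_add_diff_inverse)
      obtain e where e: "?K = ?u + e" using U(3) le_Suc_ex by blast
      have diff: "?K - ?u = e" "?K - card S = e + d + a" "?K - (card S + a) = e + d"
        using a(1) d(1) e by linarith+
      have "?F (cons_column ?K m S g) =
          p ^ (?z g + (e + d + a) + t * (e + d)) * ?y ^ (card S + a)"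
        by (simp only: num_entries_cons_column[OF SK] free_rows_cons_column[OF S] diff a(1))
      also have "?z g + (e + d + a) + t * (e + d) = ?z g + Suc t * e + a + Suc t * d"
        by (simp add: algebra_simps)
      also have "p ^ \<dots> * ?y ^ (card S + a) =
          p ^ (?z g + Suc t * (?K - ?u)) * (?y ^ card S * (p * ?y) ^ a * ?c ^ d)"
        by (simp only: diff power_add power_mult_distrib ac_simps flip: power_mult)
      finally show ?thesis by (simp only: a(2) d(2))
    qed
    then have "(\<Sum>S\<in>Pow (?U g) - {{}}. ?F (cons_column ?K m S g)) =
        p ^ (?z g + Suc t * (?K - ?u)) * (\<Sum>S\<in>Pow (?U g) - {{}}.
          ?y ^ card S * (p * ?y) ^ card (?V S - S) * ?c ^ card (?U g - ?V S))"
      unfolding sum_distrib_left by (intro sum.cong) auto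
    also have "\<dots> = p ^ (?z g + Suc t * (?K - ?u)) *
        (?y * (q_nat p (Suc (Suc t)) ^ ?u - (p * ?y) ^ ?u))"
    proof -
      have "?y + ?c = q_nat p (Suc (Suc t))" by (simp only: q_nat_Suc)
      moreover have "?y + ?c = 1 + p * ?y"
        by (simp only: flip: q_nat_Suc q_nat_Suc_shift)
      ultimately show ?thesis using sum_first_columns[OF U(1), of ?y ?c "p * ?y" g] by simp
    qed
    also have "\<dots> = ?y * (p ^ (?z g + Suc t * (?K - ?u)) * q_nat p (Suc (Suc t)) ^ ?u -
        p ^ ?K * (p ^ (?z g + t * (?K - ?u)) * ?y ^ ?u))"
    proof -
      obtain e where e: "?K = ?u + e" using U(3) le_Suc_ex by blast
      \<comment> \<open>A factor \<open>p\<close> from each of the \<open>?u\<close> free rows and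
        the excess \<open>p ^ e\<close> of \<open>t + 1\<close> over \<open>t\<close> on the other
        rows combine to \<open>p ^ ?K\<close>.\<close>
      have "p ^ (?z g + Suc t * e) * (p * ?y) ^ ?u = p ^ (?u + e) * (p ^ (?z g + t * e) * ?y ^ ?u)"
        by (simp only: mult_Suc mult_Suc_right power_add power_mult_distrib ac_simps)
      moreover have "?K - ?u = e" using e by linarith
      moreover have "p ^ ?K = p ^ (?u + e)" by (rule arg_cong[OF e])
      ultimately show ?thesis by (simp only: right_diff_distrib mult.left_commute)
    qed
    finally show "(\<Sum>S\<in>Pow (?U g) - {{}}. ?F (cons_column ?K m S g)) = \<dots>" .
  qed simp
  also have "\<dots> = ?y * (row_sum p (Suc t) ?K m - p ^ ?K * row_sum p t ?K m)"
    unfolding row_sum_def by (simp only: sum_subtractf flip: sum_distrib_left)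
  finally show ?thesis .
qed

subsection \<open>Recurrences in the number of rows and columns\<close>

text \<open>The box in the last row and first column decides: with a 2 the last row is empty,
  otherwise the first column is full.\<close>

lemma row_sum_step:
  "row_sum p t (Suc k) (Suc m) = q_nat p (Suc t) *
     (row_sum p t k (Suc m) + row_sum p (Suc t) (Suc k) m - p ^ Suc k * row_sum p t (Suc k) m)"
proof -
  have "fillings (Suc k) (Suc m) = {f. f \<in> fillings (Suc k) (Suc m) \<and> f (k, 0) = 2} \<union>
      {f. f \<in> fillings (Suc k) (Suc m) \<and> f (k, 0) \<noteq> 2}" (is "_ = ?A \<union> ?B") by auto
  moreover have "finite ?A" "finite ?B" "?A \<inter> ?B = {}" by auto
  ultimately have "row_sum p t (Suc k) (Suc m) = q_nat p (Suc t) * row_sum p t k (Suc m) +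
      q_nat p (Suc t) * (row_sum p (Suc t) (Suc k) m - p ^ Suc k * row_sum p t (Suc k) m)"
    unfolding row_sum_last_row_empty[symmetric, OF zero_less_Suc]
      row_sum_first_column_full[symmetric] row_sum_def[of p t "Suc k" "Suc m"]
    by (metis (no_types, lifting) sum.union_disjoint)
  then show ?thesis by (simp add: algebra_simps)
qed


text \<open>Found by computing small cases; for \<open>t = 0\<close> it is Carlitz' recurrence. Substituting it into the
  terms on the right of \<open>row_sum_step\<close>, everything matches except the coefficient of
  \<open>row_sum p t k m\<close>, where one needs \<open>[k + 1] - p\<^sup>k [m + t + 2] = [k] - p\<^sup>k\<^sup>+\<^sup>1 [m + t + 1]\<close>.\<close>

lemma row_sum_rec:
  "row_sum p t (Suc k) (Suc m) =
     q_nat p (Suc k) * row_sum p t (Suc k) m + q_nat p (Suc (Suc (m + t))) * row_sum p t k (Suc m)"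
proof (induction "k + m" arbitrary: t k m rule: less_induct)
  case less
  let ?R = "row_sum p"
  let ?y = "q_nat p (Suc t)" and ?a = "q_nat p (Suc k)" and ?b = "q_nat p (Suc (Suc (m + t)))"
  let ?c = "q_nat p (Suc (m + t))"
  have a: "?a = q_nat p k + p ^ k" by (simp add: q_nat_Suc)
  have b: "?b = 1 + p * ?c" by (rule q_nat_Suc_shift)
  \<comment> \<open>\<open>X\<close> is the sum for \<open>k - 1\<close> rows and
    \<open>m + 1\<close> columns. For \<open>k = 0\<close> it is replaced by 0, and both equations
    hold because sums without rows do not depend on \<open>t\<close>.\<close>
  obtain X where X: "?R t k (Suc m) = q_nat p k * ?R t k m + ?b * X"
    "?R t k (Suc m) = ?y * (X + ?R (Suc t) k m - p ^ k * ?R t k m)"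
  proof (cases k)
    case 0
    have "?R (Suc t) 0 m = ?R t 0 m"
      by (cases m) (simp_all add: row_sum_no_columns row_sum_no_rows)
    then show ?thesis using that[of 0] 0 by (simp add: row_sum_no_rows)
  next
    case (Suc l)
    then show ?thesis using that[of "?R t l (Suc m)"] less[of l m t] row_sum_step[of p t l m]
      by simp
  qed
  \<comment> \<open>\<open>Y\<close> and \<open>Z\<close> are the sums for \<open>k + 1\<close> rows
    and \<open>m - 1\<close> columns at \<open>t\<close> and \<open>t + 1\<close>, so the induction
    hypothesis is needed for both parameters. For \<open>m = 0\<close> both are replaced by
    0.\<close>
  obtain Y Z where YZ: "?R t (Suc k) m = ?a * Y + ?c * ?R t k m"
    "?R (Suc t) (Suc k) m = ?a * Z + ?b * ?R (Suc t) k m"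
    "?R t (Suc k) m = ?y * (?R t k m + Z - p ^ Suc k * Y)"
  proof (cases m)
    case 0
    then show ?thesis using that[of 0 0] by (simp add: row_sum_no_columns)
  next
    case (Suc l)
    then show ?thesis using that[of "?R t (Suc k) l" "?R (Suc t) (Suc k) l"]
      less[of k l t] less[of k l "Suc t"] row_sum_step[of p t k l] by simp
  qed
  have "?R t (Suc k) (Suc m) =
      ?y * (?R t k (Suc m) + ?R (Suc t) (Suc k) m - p ^ Suc k * ?R t (Suc k) m)"
    by (rule row_sum_step)
  also have "\<dots> = ?y * ((q_nat p k * ?R t k m + ?b * X) + (?a * Z + ?b * ?R (Suc t) k m) -
      p ^ Suc k * (?a * Y + ?c * ?R t k m))"
    by (simp only: X(1) YZ(1,2))
  also have "\<dots> = ?a * (?y * (?R t k m + Z - p ^ Suc k * Y)) +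
      ?b * (?y * (X + ?R (Suc t) k m - p ^ k * ?R t k m))"
    unfolding a b by (simp add: algebra_simps)
  also have "\<dots> = ?a * ?R t (Suc k) m + ?b * ?R t k (Suc m)"
    by (simp only: X(2) YZ(3))
  finally show ?case .
qed

section \<open>Matching the recurrences for tableaux and permutations\<close>

lemma row_sum_eq_carlitz_B: "row_sum p 0 (Suc k) m = carlitz_B (Suc (k + m)) (Suc k) p"
proof (induction "k + m" arbitrary: k m)
  case 0
  then show ?case using carlitz_B_1[of p] by (simp add: row_sum_no_columns)
next
  case (Suc n)
  \<comment> \<open>Since \<open>k + m = Suc n\<close>, the index \<open>Suc (Suc n) - k\<close> of
    the second coefficient is \<open>Suc m\<close>.\<close>
  have B: "carlitz_B (Suc (k + m)) (Suc k) p =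
      q_nat p (Suc k) * carlitz_B (Suc n) (Suc k) p + q_nat p (Suc m) * carlitz_B (Suc n) k p"
    using carlitz_B_Suc[of "Suc n" k p] Suc.hyps(2) by (simp add: Suc_diff_le)
  have 1: "q_nat p (Suc m) * carlitz_B (Suc n) k p = q_nat p (Suc m) * row_sum p 0 k m"
    if "m > 0"
  proof (cases k)
    case 0
    then show ?thesis using that by (cases m) (simp_all add: carlitz_B_0 row_sum_no_rows)
  next
    case (Suc l)
    then show ?thesis using Suc.hyps(1)[of l m] Suc.hyps(2) by simp
  qed
  show ?case
  \<comment> \<open>Without columns \<open>row_sum_rec\<close> does not apply. Then
    \<open>k = n + 1\<close>, the first term of \<open>B\<close> vanishes because
    \<open>n + 1\<close> letters have at most \<open>n\<close> descents, and both sides equal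
    1.\<close>
  proof (cases m)
    case 0
    then obtain l where l: "k = Suc l" "n = l" using Suc.hyps(2) by (cases k) auto
    have "carlitz_B (Suc n) (Suc k) p = 0" using l by (intro carlitz_B_eq_0) auto
    moreover have "carlitz_B (Suc n) k p = 1"
      using Suc.hyps(1)[of l 0] l by (simp add: row_sum_no_columns)
    ultimately show ?thesis using B 0 by (simp add: row_sum_no_columns)
  next
    case (Suc l)
    then have "row_sum p 0 (Suc k) l = carlitz_B (Suc n) (Suc k) p"
      using Suc.hyps(1)[of k l] Suc.hyps(2) by simp
    then show ?thesis using B 1 row_sum_rec[of p 0 k l] Suc by simp
  qed
qed

theorem proposition32:
  fixes n k :: nat
  assumes "1 \<le> k" and "k \<le> n"
  shows "D_tab k n [:0, 1:] 1 1 = carlitz_B n k ([:0, 1:] :: int poly)"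
  using row_sum_eq_carlitz_B[of "[:0, 1:] :: int poly" "k - 1" "n - k"] assms
  by (simp add: D_tab_eq_row_sum)

end
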